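(* Let $p$ and $q$ be distinct primes with $pq\neq 6$ and $q\mid p-1$. Let $r$ be an integer with $r^{q}\equiv 1 \pmod{p^{2}}$ and $r\not\equiv 1\pmod{p^2}$, and let $G=\langle a,b,c\mid a^{q}=b^{q}=c^{p^{2}}=1,\ [a,b]=[b,c]=1,\ a^{-1}ca=c^{r}\rangle$. Then $\mathrm{Aut}(G)\simeq \mathbb{Z}_{p^{2}}\rtimes(\mathbb{Z}_{p(p-1)}\times(\mathbb{Z}_{q}\rtimes\mathbb{Z}_{q-1}))$.
   Context: $\mathbb{Z}_n$ is the cyclic group of order $n$; $[x,y]=x^{-1}y^{-1}xy$. $X\rtimes Y$ denotes a semidirect product with normal subgroup $X$ with respect to some homomorphism $Y\to\mathrm{Aut}(X)$; the statement asserts that $\mathrm{Aut}(G)$ is isomorphic to such an (iterated) semidirect product for some choice of actions. *)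

theory Defs
  imports
    "HOL-Algebra.Bij"
    "HOL-Algebra.Elementary_Groups"
    "HOL-Computational_Algebra.Primes"
    "HOL-Number_Theory.Cong"
begin

section \<open>Groups given by generators and relations\<close>

text \<open>
  A letter \<open>(True, x)\<close> stands for the generator \<open>x\<close> and \<open>(False, x)\<close> for its formal
  inverse. A relation \<open>u = v\<close> is encoded as the pair \<open>(u, v)\<close>.
\<close>

type_synonym 'g gword = "(bool \<times> 'g) list"

definition gen_word :: "'g \<Rightarrow> 'g gword" where
  "gen_word x = [(True, x)]"

definition inv_word :: "'g gword \<Rightarrow> 'g gword" where
  "inv_word w = rev (map (\<lambda>(s, x). (\<not> s, x)) w)"

definition pow_word :: "'g gword \<Rightarrow> int \<Rightarrow> 'g gword" where
  "pow_word w n =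
     (if n \<ge> 0 then concat (replicate (nat n) w)
      else concat (replicate (nat (- n)) (inv_word w)))"

definition comm_word :: "'g gword \<Rightarrow> 'g gword \<Rightarrow> 'g gword" where
  "comm_word x y = inv_word x @ inv_word y @ x @ y"

inductive word_equiv :: "('g gword \<times> 'g gword) set \<Rightarrow> 'g gword \<Rightarrow> 'g gword \<Rightarrow> bool"
  for R :: "('g gword \<times> 'g gword) set"
where
  word_equiv_refl: "word_equiv R u u"
| word_equiv_sym: "word_equiv R u v \<Longrightarrow> word_equiv R v u"
| word_equiv_trans: "word_equiv R u v \<Longrightarrow> word_equiv R v w \<Longrightarrow> word_equiv R u w"
| word_equiv_cancel: "word_equiv R (u @ [(s, x), (\<not> s, x)] @ v) (u @ v)"
| word_equiv_relation: "(l, r) \<in> R \<Longrightarrow> word_equiv R (u @ l @ v) (u @ r @ v)"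

definition word_class :: "('g gword \<times> 'g gword) set \<Rightarrow> 'g gword \<Rightarrow> 'g gword set" where
  "word_class R w = {v. word_equiv R w v}"

text \<open>
  The generators are all elements of the type \<open>'g\<close>. The union in the product is over
  equal classes, see \<open>mult_word_class\<close>.
\<close>

definition presented_group :: "('g gword \<times> 'g gword) set \<Rightarrow> 'g gword set monoid" where
  "presented_group R =
     \<lparr>carrier = range (word_class R),
      monoid.mult = (\<lambda>S T. \<Union>u\<in>S. \<Union>v\<in>T. word_class R (u @ v)),
      one = word_class R []\<rparr>"

lemma word_equiv_context:
  "word_equiv R u v \<Longrightarrow> word_equiv R (x @ u @ y) (x @ v @ y)"
proof (induction rule: word_equiv.induct)
  case (word_equiv_cancel u s z v)
  show ?case using word_equiv.word_equiv_cancel[of R "x @ u" s z "v @ y"] by simp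
next
  case (word_equiv_relation l r u v)
  show ?case using word_equiv.word_equiv_relation[OF word_equiv_relation.hyps, of "x @ u" "v @ y"] by simp
qed (blast intro: word_equiv.intros)+

lemma word_equiv_append:
  assumes "word_equiv R u u'" "word_equiv R v v'"
  shows "word_equiv R (u @ v) (u' @ v')"
  using word_equiv_context[OF assms(1), of "[]" v] word_equiv_context[OF assms(2), of u' "[]"]
  by (auto intro: word_equiv_trans)

lemma word_class_eq_iff: "word_class R u = word_class R v \<longleftrightarrow> word_equiv R u v"
  by (auto simp: word_class_def set_eq_iff intro: word_equiv.intros)

lemma mult_word_class:
  "word_class R u \<otimes>\<^bsub>presented_group R\<^esub> word_class R v = word_class R (u @ v)"
proof -
  have *: "word_class R (x @ y) = word_class R (u @ v)"
    if "x \<in> word_class R u" "y \<in> word_class R v" for x y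
    using word_equiv_append[of R u x v y] that
    unfolding word_class_eq_iff by (simp add: word_class_def word_equiv_sym)
  have mem: "w \<in> word_class R w" for w
    by (simp add: word_class_def word_equiv_refl)
  have "(\<Union>x\<in>word_class R u. \<Union>y\<in>word_class R v. word_class R (x @ y)) =
        (\<Union>x\<in>word_class R u. \<Union>y\<in>word_class R v. word_class R (u @ v))"
    by (intro SUP_cong refl *)
  also have "\<dots> = word_class R (u @ v)"
    using mem by blast
  finally show ?thesis by (simp add: presented_group_def)
qed

lemma word_equiv_inv_word: "word_equiv R (inv_word w @ w) []"
proof (induction w)
  case Nil
  show ?case by (simp add: inv_word_def word_equiv_refl)
next
  case (Cons a w)
  obtain s x where a: "a = (s, x)" by force
  have "word_equiv R (inv_word w @ [(\<not> s, x), (\<not> \<not> s, x)] @ w) (inv_word w @ w)"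
    by (rule word_equiv_cancel)
  then show ?case using Cons by (auto simp: inv_word_def a intro: word_equiv_trans)
qed

lemma group_presented_group: "group (presented_group R)"
proof (rule groupI)
  show "\<exists>y\<in>carrier (presented_group R). y \<otimes>\<^bsub>presented_group R\<^esub> x = \<one>\<^bsub>presented_group R\<^esub>"
    if "x \<in> carrier (presented_group R)" for x
  proof -
    from that have "x \<in> range (word_class R)" by (simp add: presented_group_def)
    then obtain w where x: "x = word_class R w" by blast
    have "word_class R (inv_word w) \<otimes>\<^bsub>presented_group R\<^esub> x = \<one>\<^bsub>presented_group R\<^esub>"
      unfolding x mult_word_class by (simp add: presented_group_def word_class_eq_iff word_equiv_inv_word)
    moreover have "word_class R (inv_word w) \<in> carrier (presented_group R)"
      by (simp add: presented_group_def)
    ultimately show ?thesis by blast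
  qed
next
  have one: "\<one>\<^bsub>presented_group R\<^esub> = word_class R []"
    and car: "carrier (presented_group R) = range (word_class R)"
    by (simp_all add: presented_group_def)
  show "\<one>\<^bsub>presented_group R\<^esub> \<in> carrier (presented_group R)"
    by (simp add: one car)
  fix x y z assume "x \<in> carrier (presented_group R)" "y \<in> carrier (presented_group R)"
  then obtain u v where xy: "x = word_class R u" "y = word_class R v" by (auto simp: car)
  show "x \<otimes>\<^bsub>presented_group R\<^esub> y \<in> carrier (presented_group R)"
    by (simp add: xy mult_word_class car)
  assume "z \<in> carrier (presented_group R)"
  then obtain w where z: "z = word_class R w" by (auto simp: car)
  show "x \<otimes>\<^bsub>presented_group R\<^esub> y \<otimes>\<^bsub>presented_group R\<^esub> z =
        x \<otimes>\<^bsub>presented_group R\<^esub> (y \<otimes>\<^bsub>presented_group R\<^esub> z)"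
    by (simp add: xy z mult_word_class)
next
  fix x assume "x \<in> carrier (presented_group R)"
  then obtain u where "x = word_class R u" by (auto simp: presented_group_def)
  then show "\<one>\<^bsub>presented_group R\<^esub> \<otimes>\<^bsub>presented_group R\<^esub> x = x"
    using mult_word_class[of R "[]" u] by (simp add: presented_group_def)
qed


section \<open>Semidirect products\<close>

text \<open>Intended for the case that \<open>X\<close>, \<open>Y\<close> are groups and \<open>\<phi> \<in> hom Y (AutoGroup X)\<close>.\<close>

definition semidirect_product ::
  "('a, 'm) monoid_scheme \<Rightarrow> ('b, 'n) monoid_scheme \<Rightarrow> ('b \<Rightarrow> 'a \<Rightarrow> 'a) \<Rightarrow> ('a \<times> 'b) monoid"
where
  "semidirect_product X Y \<phi> =
     \<lparr>carrier = carrier X \<times> carrier Y,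
      monoid.mult = (\<lambda>(x, y) (x', y'). (x \<otimes>\<^bsub>X\<^esub> \<phi> y x', y \<otimes>\<^bsub>Y\<^esub> y')),
      one = (\<one>\<^bsub>X\<^esub>, \<one>\<^bsub>Y\<^esub>)\<rparr>"


section \<open>The group under consideration\<close>

datatype abc_gen = gen_a | gen_b | gen_c

definition abc_relations :: "nat \<Rightarrow> nat \<Rightarrow> int \<Rightarrow> (abc_gen gword \<times> abc_gen gword) set" where
  "abc_relations p q r =
     (let a = gen_word gen_a; b = gen_word gen_b; c = gen_word gen_c in
       {(pow_word a (int q), []),
        (pow_word b (int q), []),
        (pow_word c (int (p\<^sup>2)), []),
        (comm_word a b, []),
        (comm_word b c, []),
        (inv_word a @ c @ a, pow_word c r)})"

definition abc_group :: "nat \<Rightarrow> nat \<Rightarrow> int \<Rightarrow> abc_gen gword set monoid" where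
  "abc_group p q r = presented_group (abc_relations p q r)"

end

theory Submission
  imports Defs "HOL-Number_Theory.Residue_Primitive_Roots"
begin

text \<open>
  Every element of \<open>G\<close> can be written uniquely as \<open>c\<^sup>k a\<^sup>i b\<^sup>j\<close>, so that \<open>G\<close> is
  \<open>\<int>\<^sub>N \<rtimes> (\<int>\<^sub>q \<times> \<int>\<^sub>q)\<close> with \<open>N = p\<^sup>2\<close>, where \<open>a\<close> acts on \<open>\<int>\<^sub>N\<close> as multiplication by
  \<open>\<rho> = r\<^sup>-\<^sup>1\<close> and \<open>b\<close> acts trivially. That the defining relations do not collapse \<open>G\<close> any further is
  seen by evaluating words in this semidirect product (lemmas \<open>iso_presented_group\<close> and
  \<open>abc_group_iso\<close>).

  The numbers \<open>\<rho>\<close> and \<open>\<rho> - 1\<close> are units modulo \<open>N\<close>: if \<open>p\<close> divided \<open>\<rho> - 1\<close>, then it would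
  divide \<open>r - 1\<close>. The factor \<open>1 + r + \<dots> + r\<^sup>q\<^sup>-\<^sup>1 \<equiv> q\<close> of \<open>r\<^sup>q - 1\<close> would then be prime to
  \<open>p\<close>, and \<open>r \<equiv> 1\<close> modulo \<open>p\<^sup>2\<close> would follow (lemma \<open>cong_1_lift\<close>), contrary to the choice of
  \<open>r\<close>. Hence an automorphism has very little freedom. Since \<open>N\<close> is coprime
  to \<open>q\<close>, it maps \<open>c\<close> to some \<open>c\<^sup>u\<close>. By its action on \<open>c\<close> it maps \<open>a\<close> to some \<open>c\<^sup>t a b\<^sup>m\<close>, and
  since \<open>b\<close> is central its image is some \<open>b\<^sup>v\<close>. As \<open>1 - \<rho>\<close> is a unit, \<open>t\<close> can be written as
  \<open>s (1 - \<rho>)\<close>, and with this parameter the automorphism becomes the map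
  \<open>(k, i, j) \<mapsto> (u k + s (1 - \<rho>\<^sup>i), i, m i + v j)\<close> (lemma \<open>auto_is_affine\<close>).

  Two such maps compose by \<open>(s, u) (s', u') = (s + u s', u u')\<close> and
  \<open>(m, v) (m', v') = (m + v m', v v')\<close> (lemma \<open>affine_compose\<close>), so that the automorphism group is the
  product of the affine groups of \<open>\<int>\<^sub>N\<close> and of \<open>\<int>\<^sub>q\<close>. The factor with the pairs \<open>(m, v)\<close> acts
  trivially on the translations \<open>s\<close>, which gives the bracketing
  \<open>\<int>\<^sub>N \<rtimes> (\<int>\<^sub>N\<^sup>* \<times> (\<int>\<^sub>q \<rtimes> \<int>\<^sub>q\<^sup>*))\<close>. Primitive roots modulo \<open>p\<^sup>2\<close> and modulo \<open>q\<close> turn the two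
  groups of units into \<open>\<int>\<close> modulo \<open>p (p - 1)\<close> and modulo \<open>q - 1\<close> (lemma \<open>AutoGroup_M\<close>).
\<close>

section \<open>Evaluating words in a group\<close>

definition eval_word :: "('a, 'm) monoid_scheme \<Rightarrow> ('g \<Rightarrow> 'a) \<Rightarrow> 'g gword \<Rightarrow> 'a" where
  "eval_word H \<gamma> w =
     foldr (\<lambda>(s, x) y. (if s then \<gamma> x else inv\<^bsub>H\<^esub> \<gamma> x) \<otimes>\<^bsub>H\<^esub> y) w \<one>\<^bsub>H\<^esub>"

locale generators_in_group = group H for H (structure) +
  fixes \<gamma> :: "'g \<Rightarrow> 'a"
  assumes gen_closed [simp]: "\<gamma> x \<in> carrier H"
begin

abbreviation ev :: "'g gword \<Rightarrow> 'a" where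
  "ev \<equiv> eval_word H \<gamma>"

lemma ev_Nil [simp]: "ev [] = \<one>"
  by (simp add: eval_word_def)

lemma ev_Cons: "ev ((s, x) # w) = (if s then \<gamma> x else inv \<gamma> x) \<otimes> ev w"
  by (simp add: eval_word_def)

lemma ev_closed [simp]: "ev w \<in> carrier H"
  by (induction w) (auto simp: ev_Cons)

lemma ev_append: "ev (u @ v) = ev u \<otimes> ev v"
  by (induction u) (auto simp: ev_Cons m_assoc)

lemma ev_gen_word: "ev (gen_word x) = \<gamma> x"
  by (simp add: gen_word_def ev_Cons)

lemma ev_inv_word: "ev (inv_word w) = inv (ev w)"
proof (induction w)
  case (Cons l w)
  obtain s x where [simp]: "l = (s, x)" by force
  have "ev (inv_word (l # w)) = inv (ev w) \<otimes> (if s then inv \<gamma> x else \<gamma> x)"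
    using Cons by (simp add: inv_word_def ev_append ev_Cons)
  also have "\<dots> = inv (ev (l # w))"
    by (auto simp: ev_Cons inv_mult_group)
  finally show ?case .
qed (simp add: inv_word_def)

lemma ev_concat_replicate: "ev (concat (replicate n w)) = ev w [^] n"
  by (induction n) (simp_all only: replicate_Suc replicate_0 concat.simps ev_Nil ev_append nat_pow_Suc2 nat_pow_0 ev_closed)

lemma ev_pow_word: "ev (pow_word w n) = ev w [^] n"
proof (cases "n < 0")
  case True
  then have "pow_word w n = concat (replicate (nat (- n)) (inv_word w))"
    by (simp add: pow_word_def)
  then have "ev (pow_word w n) = inv (ev w) [^] nat (- n)"
    by (simp only: ev_concat_replicate ev_inv_word)
  with True show ?thesis
    by (simp only: int_pow_def2 nat_pow_inv ev_closed if_True)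
next
  case False
  then have "pow_word w n = concat (replicate (nat n) w)"
    by (simp add: pow_word_def)
  with False show ?thesis
    by (simp only: int_pow_def2 ev_concat_replicate if_False)
qed

lemma ev_comm_word: "ev (comm_word u v) = inv (ev u) \<otimes> (inv (ev v) \<otimes> (ev u \<otimes> ev v))"
  by (simp add: comm_word_def ev_append ev_inv_word m_assoc)

lemmas ev_simps = ev_append ev_gen_word ev_inv_word ev_pow_word ev_comm_word

text \<open>
  This is the universal property of a presented group: an assignment of the generators that
  satisfies the relations is well-defined on classes of words.
\<close>

lemma ev_word_equiv:
  assumes rel: "\<And>u v. (u, v) \<in> R \<Longrightarrow> ev u = ev v"
    and "word_equiv R u v"
  shows "ev u = ev v"
  using assms(2)
proof induction
  case (word_equiv_cancel u s x v)
  have "ev ([(s, x), (\<not> s, x)] @ v) = ev v"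
    by (auto simp: ev_Cons m_assoc[symmetric])
  then show ?case by (simp add: ev_append)
next
  case (word_equiv_relation l r u v)
  then show ?case by (simp add: ev_append rel)
qed auto

end

lemma (in generators_in_group) hom_eqI:
  assumes "group K" "f \<in> hom H K" "f' \<in> hom H K"
    and "\<And>x. f (\<gamma> x) = f' (\<gamma> x)" "carrier H \<subseteq> range ev" "y \<in> carrier H"
  shows "f y = f' y"
proof -
  interpret f: group_hom H K f
    using assms by (simp add: group_hom_def group_hom_axioms_def is_group)
  interpret f': group_hom H K f'
    using assms by (simp add: group_hom_def group_hom_axioms_def is_group)
  obtain w where "y = ev w" using assms by blast
  moreover have "f (ev w) = f' (ev w)"
    by (induction w) (auto simp: ev_Cons assms(4))
  ultimately show ?thesis by simp
qed

lemma carrier_presented_group: "carrier (presented_group R) = range (word_class R)"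
  and one_presented_group: "\<one>\<^bsub>presented_group R\<^esub> = word_class R []"
  by (simp_all add: presented_group_def)

interpretation presented: generators_in_group "presented_group R" "\<lambda>x. word_class R (gen_word x)" for R
  by (simp add: generators_in_group_def generators_in_group_axioms_def
      group_presented_group carrier_presented_group)

lemma eval_word_presented_group:
  "eval_word (presented_group R) (\<lambda>x. word_class R (gen_word x)) w = word_class R w"
proof (induction w)
  case Nil
  then show ?case by (simp add: one_presented_group)
next
  case (Cons l w)
  obtain s x where [simp]: "l = (s, x)" by force
  have "inv\<^bsub>presented_group R\<^esub> word_class R (gen_word x) = word_class R [(False, x)]"
  proof (rule presented.inv_equality)
    show "word_class R [(False, x)] \<otimes>\<^bsub>presented_group R\<^esub> word_class R (gen_word x) = \<one>\<^bsub>presented_group R\<^esub>"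
      using word_equiv_cancel[of R "[]" False x "[]"]
      by (simp add: mult_word_class one_presented_group gen_word_def word_class_eq_iff)
  qed (auto simp: carrier_presented_group)
  then show ?case
    using Cons by (cases s) (simp_all add: presented.ev_Cons mult_word_class, simp_all add: gen_word_def mult_word_class)
qed

lemma presented_group_relation:
  assumes "(u, v) \<in> R"
  shows "eval_word (presented_group R) (\<lambda>x. word_class R (gen_word x)) u =
         eval_word (presented_group R) (\<lambda>x. word_class R (gen_word x)) v"
  using word_equiv_relation[OF assms, of "[]" "[]"]
  by (simp add: eval_word_presented_group word_class_eq_iff)

text \<open>
  A map out of \<open>H\<close> is used instead of the homomorphism from the presented group to \<open>H\<close> because its
  surjectivity is then immediate from \<open>f (ev w) = word_class R w\<close>, while injectivity is the
  soundness of evaluation.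
\<close>

lemma (in generators_in_group) iso_presented_group:
  assumes rel: "\<And>u v. (u, v) \<in> R \<Longrightarrow> ev u = ev v"
    and generated: "carrier H \<subseteq> range ev"
    and f: "f \<in> hom H (presented_group R)"
    and f_gen: "\<And>x. f (\<gamma> x) = word_class R (gen_word x)"
  shows "f \<in> iso H (presented_group R)"
proof -
  interpret f: group_hom H "presented_group R" f
    using f by (simp add: group_hom_def group_hom_axioms_def group_presented_group is_group)
  have f_ev: "f (ev w) = word_class R w" for w
  proof -
    have "f (ev w) = eval_word (presented_group R) (\<lambda>x. word_class R (gen_word x)) w"
      by (induction w) (auto simp: ev_Cons presented.ev_Cons f_gen)
    then show ?thesis by (simp add: eval_word_presented_group)
  qed
  have "inj_on f (carrier H)"
  proof (rule inj_onI)
    fix x y assume "x \<in> carrier H" "y \<in> carrier H" and eq: "f x = f y"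
    then obtain u v where "x = ev u" "y = ev v" using generated by blast
    with eq show "x = y"
      using ev_word_equiv[OF rel] by (simp add: f_ev word_class_eq_iff)
  qed
  moreover have "f ` carrier H = carrier (presented_group R)"
  proof
    show "carrier (presented_group R) \<subseteq> f ` carrier H"
      by (auto simp: carrier_presented_group simp flip: f_ev)
  qed auto
  ultimately show ?thesis
    using f by (simp add: iso_iff)
qed


section \<open>Automorphism groups and semidirect products\<close>

lemma carrier_AutoGroup: "carrier (AutoGroup G) = auto G"
  by (simp add: AutoGroup_def)

lemma one_AutoGroup: "\<one>\<^bsub>AutoGroup G\<^esub> = (\<lambda>x\<in>carrier G. x)"
  by (simp add: AutoGroup_def BijGroup_def)

lemma mult_AutoGroup:
  assumes "f \<in> auto G" "g \<in> auto G"
  shows "f \<otimes>\<^bsub>AutoGroup G\<^esub> g = compose (carrier G) f g"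
  using assms by (simp add: AutoGroup_def BijGroup_def auto_def)

lemma auto_iff:
  "f \<in> auto G \<longleftrightarrow> f \<in> iso G G \<and> f \<in> extensional (carrier G)"
  by (auto simp: auto_def Bij_def iso_def)

lemma AutoGroup_iso_cong:
  assumes "group G" "group H" "G \<cong> H"
  shows "AutoGroup G \<cong> AutoGroup H"
proof -
  interpret G: group G by fact
  interpret H: group H by fact
  obtain h where h: "h \<in> iso G H" using assms(3) by (auto simp: is_iso_def)
  define k where "k = inv_into (carrier G) h"
  have k: "k \<in> iso H G" using G.iso_set_sym[OF h] by (simp add: k_def)
  have hc: "h x \<in> carrier H" if "x \<in> carrier G" for x
    using h that by (auto simp: iso_def hom_def)
  have kc: "k x \<in> carrier G" if "x \<in> carrier H" for x
    using k that by (auto simp: iso_def hom_def)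
  have hk: "h (k x) = x" if "x \<in> carrier H" for x
    using h that unfolding k_def by (auto simp: iso_iff intro: f_inv_into_f)
  have kh: "k (h x) = x" if "x \<in> carrier G" for x
    using h that unfolding k_def by (auto simp: iso_iff)
  define F where "F = (\<lambda>f. \<lambda>x\<in>carrier H. h (f (k x)))"
  define F' where "F' = (\<lambda>f. \<lambda>x\<in>carrier G. k (f (h x)))"
  have restrict_iso: "restrict f (carrier A) \<in> iso A B"
    if "f \<in> iso A B" "group A" for f and A :: "('x, 'u) monoid_scheme" and B :: "('y, 'v) monoid_scheme"
  proof -
    interpret A: group A by fact
    show ?thesis using that(1)
      by (auto simp: iso_def hom_def cong: bij_betw_cong)
  qed
  have Fauto: "F f \<in> auto H" if "f \<in> auto G" for f
    using restrict_iso[OF iso_set_trans[OF k iso_set_trans[OF _ h]], of f] that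
    by (simp add: auto_iff F_def comp_def H.is_group)
  have F'auto: "F' f \<in> auto G" if "f \<in> auto H" for f
    using restrict_iso[OF iso_set_trans[OF h iso_set_trans[OF _ k]], of f] that
    by (simp add: auto_iff F'_def comp_def G.is_group)
  have fc: "f x \<in> carrier A" if "f \<in> auto A" "x \<in> carrier A"
    for f x and A :: "('x, 'u) monoid_scheme"
    using that by (auto simp: auto_def hom_def)
  have "F \<in> iso (AutoGroup G) (AutoGroup H)"
    unfolding iso_def
  proof (intro CollectI conjI homI)
    fix f assume "f \<in> carrier (AutoGroup G)"
    then show "F f \<in> carrier (AutoGroup H)" by (simp add: Fauto carrier_AutoGroup)
  next
    fix f g assume "f \<in> carrier (AutoGroup G)" "g \<in> carrier (AutoGroup G)"
    then have fg: "f \<in> auto G" "g \<in> auto G" by (simp_all add: carrier_AutoGroup)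
    show "F (f \<otimes>\<^bsub>AutoGroup G\<^esub> g) = F f \<otimes>\<^bsub>AutoGroup H\<^esub> F g"
    proof -
      have "F (compose (carrier G) f g) = compose (carrier H) (F f) (F g)"
        using fg by (auto simp: F_def compose_def kc hc kh fc intro!: restrict_ext)
      then show ?thesis using fg by (simp add: mult_AutoGroup Fauto)
    qed
  next
    show "bij_betw F (carrier (AutoGroup G)) (carrier (AutoGroup H))"
    proof (rule bij_betw_byWitness[where f' = F'])
      show "\<forall>f\<in>carrier (AutoGroup G). F' (F f) = f"
      proof
        fix f assume "f \<in> carrier (AutoGroup G)"
        then have f: "f \<in> auto G" by (simp add: carrier_AutoGroup)
        then show "F' (F f) = f"
          by (intro extensionalityI[of _ "carrier G"]) (auto simp: F_def F'_def auto_iff[of f] hc kh fc[OF f])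
      qed
      show "\<forall>f\<in>carrier (AutoGroup H). F (F' f) = f"
      proof
        fix f assume "f \<in> carrier (AutoGroup H)"
        then have f: "f \<in> auto H" by (simp add: carrier_AutoGroup)
        then show "F (F' f) = f"
          by (intro extensionalityI[of _ "carrier H"]) (auto simp: F_def F'_def auto_iff[of f] kc hk fc[OF f])
      qed
    qed (auto simp: carrier_AutoGroup Fauto F'auto)
  qed
  then show ?thesis by (rule is_isoI)
qed

lemma carrier_semidirect_product [simp]:
  "carrier (semidirect_product X Y \<phi>) = carrier X \<times> carrier Y"
  and one_semidirect_product [simp]:
  "\<one>\<^bsub>semidirect_product X Y \<phi>\<^esub> = (\<one>\<^bsub>X\<^esub>, \<one>\<^bsub>Y\<^esub>)"
  and mult_semidirect_product [simp]:
  "(x, y) \<otimes>\<^bsub>semidirect_product X Y \<phi>\<^esub> (x', y') = (x \<otimes>\<^bsub>X\<^esub> \<phi> y x', y \<otimes>\<^bsub>Y\<^esub> y')"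
  by (simp_all add: semidirect_product_def)

lemma group_semidirect_product:
  assumes "group X" "group Y" and \<phi>: "\<phi> \<in> hom Y (AutoGroup X)"
  shows "group (semidirect_product X Y \<phi>)"
proof -
  interpret X: group X by fact
  interpret Y: group Y by fact
  interpret \<phi>: group_hom Y "AutoGroup X" \<phi>
    using \<phi> by (simp add: group_hom_def group_hom_axioms_def X.AutoGroup Y.is_group)
  have auto: "\<phi> y \<in> auto X" if "y \<in> carrier Y" for y
    using \<phi>.hom_closed[OF that] by (simp add: carrier_AutoGroup)
  have closed: "\<phi> y x \<in> carrier X" if "y \<in> carrier Y" "x \<in> carrier X" for x y
    using auto[OF that(1)] that(2) by (auto simp: auto_def hom_def)
  have mult: "\<phi> y (x \<otimes>\<^bsub>X\<^esub> x') = \<phi> y x \<otimes>\<^bsub>X\<^esub> \<phi> y x'"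
    if "y \<in> carrier Y" "x \<in> carrier X" "x' \<in> carrier X" for x x' y
    using auto[OF that(1)] that by (auto simp: auto_def hom_def)
  have act: "\<phi> (y \<otimes>\<^bsub>Y\<^esub> y') x = \<phi> y (\<phi> y' x)"
    if "y \<in> carrier Y" "y' \<in> carrier Y" "x \<in> carrier X" for x y y'
    using that by (simp add: mult_AutoGroup auto compose_def)
  have one: "\<phi> \<one>\<^bsub>Y\<^esub> x = x" if "x \<in> carrier X" for x
    using that by (simp add: one_AutoGroup)
  show ?thesis
  proof (rule groupI, goal_cases)
    case (5 z)
    then obtain x y where [simp]: "z = (x, y)" "x \<in> carrier X" "y \<in> carrier Y" by auto
    have "(\<phi> (inv\<^bsub>Y\<^esub> y) (inv\<^bsub>X\<^esub> x), inv\<^bsub>Y\<^esub> y) \<otimes>\<^bsub>semidirect_product X Y \<phi>\<^esub> z = \<one>\<^bsub>semidirect_product X Y \<phi>\<^esub>"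
      using mult[of "inv\<^bsub>Y\<^esub> y" "inv\<^bsub>X\<^esub> x" x] mult[of "inv\<^bsub>Y\<^esub> y" "\<one>\<^bsub>X\<^esub>" "\<one>\<^bsub>X\<^esub>"] closed[of "inv\<^bsub>Y\<^esub> y" "\<one>\<^bsub>X\<^esub>"]
      by simp
    moreover have "(\<phi> (inv\<^bsub>Y\<^esub> y) (inv\<^bsub>X\<^esub> x), inv\<^bsub>Y\<^esub> y) \<in> carrier (semidirect_product X Y \<phi>)"
      using closed[of "inv\<^bsub>Y\<^esub> y" "inv\<^bsub>X\<^esub> x"] by simp
    ultimately show ?case by blast
  qed (auto simp: closed mult act one X.m_assoc Y.m_assoc simp del: \<phi>.hom_mult \<phi>.hom_one)
qed

text \<open>
  The exponent \<open>x\<close> is an element of \<open>\<int>\<^sub>d\<close>, where \<open>g ^ d\<close> is 1 modulo \<open>n\<close>. Thus \<open>scaling n g\<close> is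
  the action of \<open>\<int>\<^sub>d\<close> on \<open>\<int>\<^sub>n\<close> through powers of the unit \<open>g\<close>. All the actions below have this
  form.
\<close>

definition scaling :: "nat \<Rightarrow> int \<Rightarrow> int \<Rightarrow> int \<Rightarrow> int" where
  "scaling n g x = (\<lambda>s\<in>carrier (integer_mod_group n). (g ^ nat x * s) mod int n)"

lemma pow_nat_mod_cong:
  fixes g m :: int
  assumes "[g ^ d = 1] (mod m)"  "d > 0" "x \<ge> 0"
  shows "[g ^ nat (x mod int d) = g ^ nat x] (mod m)"
proof -
  have "nat x = d * nat (x div int d) + nat (x mod int d)"
    using assms(2,3) by (metis mult_div_mod_eq nat_div_distrib nat_int nat_mod_distrib of_nat_0_le_iff)
  then have "g ^ nat x = (g ^ d) ^ nat (x div int d) * g ^ nat (x mod int d)"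
    by (metis power_add power_mult)
  moreover have "[(g ^ d) ^ nat (x div int d) * g ^ nat (x mod int d) = 1 ^ nat (x div int d) * g ^ nat (x mod int d)] (mod m)"
    by (intro cong_mult cong_pow assms cong_refl)
  ultimately show ?thesis by (simp add: cong_sym)
qed

lemma scaling_hom:
  assumes n: "n > 0" and d: "d > 0" and gd: "[g ^ d = 1] (mod int n)"
  shows "scaling n g \<in> hom (integer_mod_group d) (AutoGroup (integer_mod_group n))"
proof -
  have cop: "coprime g (int n)"
  proof -
    have "coprime (g ^ d) (int n)"
      using cong_imp_coprime[OF cong_sym[OF gd]] by simp
    then show ?thesis using d by simp
  qed
  have auto: "scaling n g x \<in> auto (integer_mod_group n)" for x
    unfolding auto_iff
  proof
    have hom: "scaling n g x \<in> hom (integer_mod_group n) (integer_mod_group n)"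
      using n by (intro homI)
        (auto simp: scaling_def carrier_integer_mod_group algebra_simps mod_simps)
    have inj: "inj_on (scaling n g x) (carrier (integer_mod_group n))"
    proof (rule inj_onI)
      fix s t assume st: "s \<in> carrier (integer_mod_group n)" "t \<in> carrier (integer_mod_group n)"
        and "scaling n g x s = scaling n g x t"
      then have "[g ^ nat x * s = g ^ nat x * t] (mod int n)"
        by (simp add: scaling_def cong_def)
      then have "[s = t] (mod int n)"
        using cop by (simp add: cong_mult_lcancel)
      then show "s = t"
        using st n by (simp add: carrier_integer_mod_group cong_def)
    qed
    have "scaling n g x ` carrier (integer_mod_group n) = carrier (integer_mod_group n)"
      using hom n by (intro endo_inj_surj inj) (auto simp: carrier_integer_mod_group hom_def)
    with hom inj show "scaling n g x \<in> iso (integer_mod_group n) (integer_mod_group n)"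
      by (simp add: iso_iff)
  qed (simp add: scaling_def)
  show ?thesis
  proof (rule homI)
    fix x y assume xy: "x \<in> carrier (integer_mod_group d)" "y \<in> carrier (integer_mod_group d)"
    then have pos: "x \<ge> 0" "y \<ge> 0" using d by (simp_all add: carrier_integer_mod_group)
    have pow: "[g ^ nat ((x + y) mod int d) = g ^ nat x * g ^ nat y] (mod int n)"
      using pow_nat_mod_cong[OF gd d, of "x + y"] pos
      by (simp add: nat_add_distrib power_add)
    have "scaling n g (x \<otimes>\<^bsub>integer_mod_group d\<^esub> y) s =
        compose (carrier (integer_mod_group n)) (scaling n g x) (scaling n g y) s" for s
    proof (cases "s \<in> carrier (integer_mod_group n)")
      case True
      have "(g ^ nat ((x + y) mod int d) * s) mod int n = (g ^ nat x * ((g ^ nat y * s) mod int n)) mod int n"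
        using cong_scalar_right[OF pow, of s] by (simp add: cong_def mod_mult_right_eq mult.assoc)
      with True show ?thesis
        using n by (simp add: scaling_def compose_def carrier_integer_mod_group)
    qed (simp add: scaling_def compose_def)
    then show "scaling n g (x \<otimes>\<^bsub>integer_mod_group d\<^esub> y) =
        scaling n g x \<otimes>\<^bsub>AutoGroup (integer_mod_group n)\<^esub> scaling n g y"
      by (simp add: mult_AutoGroup auto fun_eq_iff)
  qed (simp add: carrier_AutoGroup auto)
qed

section \<open>Arithmetic modulo an integer with a primitive root\<close>

lemma primroot_power_exists:
  assumes "residue_primroot n g" "n > 1" "coprime u (int n)"
  shows "\<exists>x. 0 \<le> x \<and> x < int (totient n) \<and> [int g ^ nat x = u] (mod int n)"
proof -
  define k where "k = nat (u mod int n)"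
  have k: "int k = u mod int n" using assms(2) by (simp add: k_def)
  then have "coprime (int k) (int n)" using assms(2,3) by simp
  then have "coprime k n" by simp
  moreover from this assms(2) have "k > 0" by (intro Nat.gr0I) auto
  moreover have "int k < int n" using k assms(2) by simp
  ultimately have "k \<in> totatives n" by (simp add: totatives_def)
  then obtain i where i: "i < totient n" "k = g ^ i mod n"
    using residue_primroot_is_generator[OF assms(2,1)] unfolding bij_betw_def by blast
  have "[int g ^ i = u] (mod int n)"
    using k unfolding i(2) cong_def by (simp add: of_nat_mod)
  with i(1) show ?thesis by (intro exI[of _ "int i"]) auto
qed

lemma primroot_power_inj:
  assumes "residue_primroot n g" "n > 1" "[int g ^ nat x = int g ^ nat y] (mod int n)"
    and "0 \<le> x" "x < int (totient n)" "0 \<le> y" "y < int (totient n)"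
  shows "x = y"
proof -
  have "g ^ nat x mod n = g ^ nat y mod n"
    using assms(3) unfolding cong_def by (metis of_nat_eq_iff of_nat_mod of_nat_power)
  then have "nat x = nat y"
    using residue_primroot_is_generator[OF assms(2,1)] assms
    by (auto simp: bij_betw_def dest!: inj_onD)
  with assms show ?thesis by simp
qed

lemma primroot_power_totient:
  assumes "residue_primroot n g"
  shows "[int g ^ totient n = 1] (mod int n)"
  using euler_theorem[of g n] assms
  by (metis cong_int_iff coprime_commute of_nat_1 of_nat_power residue_primroot_def)

lemma primroot_coprime:
  assumes "residue_primroot n g"
  shows "coprime (int g ^ x) (int n)"
  using assms by (auto simp: residue_primroot_def coprime_commute)

text \<open>
  Otherwise \<open>n\<close> divided by the common factor would be a nonzero element that is mapped to \<open>0\<close>.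
\<close>

lemma coprime_if_inj_scaling:
  assumes "n > 0" "inj_on (\<lambda>x. (u * x) mod int n) {0..<int n}"
  shows "coprime u (int n)"
proof -
  define d where "d = gcd u (int n)"
  have d: "d > 0" "d dvd int n" "d dvd u" using assms(1) by (auto simp: d_def)
  then obtain e f where ef: "int n = d * e" "u = d * f" by (elim dvdE)
  have "e > 0" using ef assms(1) d by (metis of_nat_0_less_iff zero_less_mult_pos)
  show ?thesis
  proof (rule ccontr)
    assume "\<not> coprime u (int n)"
    then have "d \<noteq> 1" by (simp add: d_def coprime_iff_gcd_eq_1)
    then have "d > 1" using d(1) by linarith
    then have "e \<in> {0..<int n}" using \<open>e > 0\<close> by (simp add: ef)
    moreover have "u * e mod int n = u * 0 mod int n"
      by (simp add: ef ac_simps)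
    ultimately show False
      using inj_onD[OF assms(2), of e 0] \<open>e > 0\<close> assms(1) by auto
  qed
qed

lemma hom_integer_mod_group_coprime:
  assumes "f \<in> hom (integer_mod_group m) (integer_mod_group n)" "coprime m n" "n > 0"
    and x: "x \<in> carrier (integer_mod_group m)"
  shows "f x = 0"
proof -
  interpret f: group_hom "integer_mod_group m" "integer_mod_group n" f
    using assms by (simp add: group_hom_def group_hom_axioms_def)
  have "(int m * f x) mod int n = 0"
    using f.hom_nat_pow[OF x, of m] f.hom_one by simp
  then have "int n dvd f x"
    using assms(2) by (metis coprime_commute coprime_dvd_mult_right_iff coprime_int_iff dvd_eq_mod_eq_0)
  moreover have "f x \<in> {0..<int n}"
    using f.hom_closed[OF x] assms(3) by (simp add: carrier_integer_mod_group)
  ultimately show ?thesis by (auto simp: zdvd_not_zless intro: ccontr dest: zdvd_imp_le)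
qed

lemma power_cong_1_coprime:
  fixes x m :: int
  assumes "[x ^ a = 1] (mod m)" "[x ^ b = 1] (mod m)" "coprime a b"
  shows "[x = 1] (mod m)"
proof (cases "a = 0")
  case True
  with assms show ?thesis by simp
next
  case False
  then obtain k l where "a * k = b * l + 1"
    using bezout_nat[of a b] assms(3) by (auto simp: coprime_iff_gcd_eq_1)
  then have "(x ^ a) ^ k = (x ^ b) ^ l * x"
    by (metis power_mult power_add power_one_right)
  moreover have "[(x ^ a) ^ k = 1 ^ k] (mod m)" "[(x ^ b) ^ l * x = 1 ^ l * x] (mod m)"
    by (intro cong_mult cong_pow assms cong_refl)+
  ultimately show ?thesis
    by (metis cong_sym cong_trans mult_1 power_one)
qed

text \<open>
  In \<open>r ^ n - 1 = (r - 1) * (\<Sum>i<n. r ^ i)\<close> the second factor is congruent to \<open>n\<close> modulo \<open>m\<close>,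
  so \<open>m ^ e\<close> has to divide the first one.
\<close>

lemma cong_1_lift:
  fixes r m :: int
  assumes "[r = 1] (mod m)" "coprime (int n) m" "[r ^ n = 1] (mod m ^ e)"
  shows "[r = 1] (mod m ^ e)"
proof -
  have "[(\<Sum>i<n. r ^ i) = (\<Sum>i<n. 1 ^ i)] (mod m)"
    by (intro cong_sum cong_pow assms)
  then have "[int n = (\<Sum>i<n. r ^ i)] (mod m)"
    by (simp add: cong_sym)
  then have "coprime (\<Sum>i<n. r ^ i) m"
    using assms(2) cong_imp_coprime by blast
  then have "coprime (m ^ e) (\<Sum>i<n. r ^ i)"
    by (simp add: coprime_commute)
  moreover have "m ^ e dvd (r - 1) * (\<Sum>i<n. r ^ i)"
    using assms(3) by (simp add: cong_iff_dvd_diff power_diff_1_eq)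
  ultimately show ?thesis
    by (simp add: cong_iff_dvd_diff coprime_dvd_mult_left_iff)
qed

lemma mod_mult_add_eq:
  fixes a b c n :: int
  shows "(a * (b mod n) + c) mod n = (a * b + c) mod n"
    and "(c + a * (b mod n)) mod n = (c + a * b) mod n"
  by (metis mod_add_left_eq mod_mult_right_eq) (metis mod_add_right_eq mod_mult_right_eq)

section \<open>A split metacyclic group times a cyclic group\<close>

text \<open>
  The semidirect product is treated for a modulus \<open>N\<close> that need not be a prime square. What matters
  is that \<open>\<rho>\<close> and \<open>\<rho> - 1\<close> are units. Together with \<open>q\<close> being prime, the latter makes \<open>\<rho>\<close> have
  order exactly \<open>q\<close>. The triple \<open>(k, i, j)\<close> stands for \<open>c\<^sup>k a\<^sup>i b\<^sup>j\<close>.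
\<close>

locale metacyclic_times_cyclic =
  fixes N q :: nat and \<rho> :: int
  assumes N_gt_1: "N > 1" and prime_q: "prime q" and coprime_N_q: "coprime N q"
    and rho_pow_q: "[\<rho> ^ q = 1] (mod int N)" and coprime_rho: "coprime (\<rho> - 1) (int N)"
begin

definition M :: "(int \<times> int \<times> int) monoid" where
  "M = semidirect_product (integer_mod_group N) (integer_mod_group q \<times>\<times> integer_mod_group q)
         (scaling N \<rho> \<circ> fst)"

lemma q_gt_1: "q > 1"
  using prime_q by (rule prime_gt_1_nat)

lemma rho_pow_mod: "i \<ge> 0 \<Longrightarrow> [\<rho> ^ nat (i mod int q) = \<rho> ^ nat i] (mod int N)"
  using pow_nat_mod_cong[OF rho_pow_q] q_gt_1 by simp

lemma rho_pow_eq_1: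
  assumes "[\<rho> ^ e = 1] (mod int N)" "e < q"
  shows "e = 0"
proof (rule ccontr)
  assume "e \<noteq> 0"
  then have "coprime e q"
    using assms(2) prime_q by (metis coprime_commute nat_dvd_not_less neq0_conv prime_imp_coprime)
  then have "[\<rho> = 1] (mod int N)"
    using power_cong_1_coprime[OF assms(1) rho_pow_q] by simp
  then have "int N dvd \<rho> - 1" by (simp add: cong_iff_dvd_diff)
  then have "is_unit (int N)"
    using coprime_rho coprime_common_divisor[of "\<rho> - 1" "int N" "int N"] by simp
  then show False using N_gt_1 by simp
qed

lemma coprime_rho_pow: "coprime (\<rho> ^ e) (int N)"
proof -
  have "coprime (\<rho> ^ q) (int N)"
    using cong_imp_coprime[OF cong_sym[OF rho_pow_q]] by simp
  then show ?thesis using q_gt_1 by simp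
qed

lemma rho_pow_inj:
  assumes "[\<rho> ^ i = \<rho> ^ j] (mod int N)" "i < q" "j < q"
  shows "i = j"
proof -
  have *: "i = j" if "[\<rho> ^ i = \<rho> ^ j] (mod int N)" "i \<le> j" "j < q" for i j
  proof -
    have "\<rho> ^ j = \<rho> ^ i * \<rho> ^ (j - i)"
      using that(2) by (simp flip: power_add)
    then have "[\<rho> ^ i * \<rho> ^ (j - i) = \<rho> ^ i * 1] (mod int N)"
      using that(1) by (simp add: cong_sym)
    then have "[\<rho> ^ (j - i) = 1] (mod int N)"
      using coprime_rho_pow[of i] by (subst (asm) cong_mult_lcancel) auto
    then have "j - i = 0"
      using that by (intro rho_pow_eq_1) auto
    then show ?thesis using that(2) by simp
  qed
  then show ?thesis
    using assms by (metis cong_sym nat_le_linear)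
qed

lemma action_hom:
  "scaling N \<rho> \<circ> fst \<in> hom (integer_mod_group q \<times>\<times> integer_mod_group q) (AutoGroup (integer_mod_group N))"
  using scaling_hom[OF _ _ rho_pow_q] N_gt_1 q_gt_1 by (simp add: hom_of_fst)

sublocale M: group M
  unfolding M_def by (intro group_semidirect_product DirProd_group action_hom) auto

lemma carrier_M: "carrier M = {0..<int N} \<times> {0..<int q} \<times> {0..<int q}"
  using N_gt_1 q_gt_1 by (simp add: M_def carrier_integer_mod_group)

lemma one_M: "\<one>\<^bsub>M\<^esub> = (0, 0, 0)"
  by (simp add: M_def)

lemma mult_M:
  assumes "k' \<in> {0..<int N}"
  shows "(k, i, j) \<otimes>\<^bsub>M\<^esub> (k', i', j') =
    ((k + \<rho> ^ nat i * k') mod int N, (i + i') mod int q, (j + j') mod int q)"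
  using assms N_gt_1 by (simp add: M_def scaling_def carrier_integer_mod_group mod_simps)

lemma c_hom: "(\<lambda>k. (k, 0, 0)) \<in> hom (integer_mod_group N) M"
  using N_gt_1 q_gt_1
  by (intro homI) (auto simp: carrier_M mult_M carrier_integer_mod_group)

lemma a_hom: "(\<lambda>i. (0, i, 0)) \<in> hom (integer_mod_group q) M"
  using N_gt_1 q_gt_1
  by (intro homI) (auto simp: carrier_M mult_M carrier_integer_mod_group)

lemma b_hom: "(\<lambda>j. (0, 0, j)) \<in> hom (integer_mod_group q) M"
  using N_gt_1 q_gt_1
  by (intro homI) (auto simp: carrier_M mult_M carrier_integer_mod_group)

fun \<gamma> :: "abc_gen \<Rightarrow> int \<times> int \<times> int" where
  "\<gamma> gen_a = (0, 1, 0)"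
| "\<gamma> gen_b = (0, 0, 1)"
| "\<gamma> gen_c = (1, 0, 0)"

sublocale gens: generators_in_group M \<gamma>
proof
  show "\<gamma> x \<in> carrier M" for x
    using N_gt_1 q_gt_1 by (cases x) (auto simp: carrier_M)
qed

lemma c_pow: "\<gamma> gen_c [^]\<^bsub>M\<^esub> (n::int) = (n mod int N, 0, 0)"
  using hom_int_pow[OF c_hom, of 1 n] N_gt_1 by (simp add: int_pow_integer_mod_group M.is_group)

lemma a_pow: "\<gamma> gen_a [^]\<^bsub>M\<^esub> (n::int) = (0, n mod int q, 0)"
  using hom_int_pow[OF a_hom, of 1 n] q_gt_1 by (simp add: int_pow_integer_mod_group M.is_group)

lemma b_pow: "\<gamma> gen_b [^]\<^bsub>M\<^esub> (n::int) = (0, 0, n mod int q)"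
  using hom_int_pow[OF b_hom, of 1 n] q_gt_1 by (simp add: int_pow_integer_mod_group M.is_group)

lemma normal_form:
  assumes "(k, i, j) \<in> carrier M"
  shows "(k, i, j) = gens.ev (pow_word (gen_word gen_c) k @ pow_word (gen_word gen_a) i @ pow_word (gen_word gen_b) j)"
  using assms N_gt_1 q_gt_1
  by (simp add: gens.ev_simps c_pow a_pow b_pow mult_M carrier_M del: \<gamma>.simps)

lemma generated: "carrier M \<subseteq> range gens.ev"
proof
  fix x assume "x \<in> carrier M"
  moreover obtain k i j where "x = (k, i, j)" by (cases x)
  ultimately show "x \<in> range gens.ev" using normal_form[of k i j] by (metis rangeI)
qed

section \<open>Automorphisms as affine maps\<close>

text \<open>
  The term \<open>s (1 - \<rho>\<^sup>i)\<close> is the exponent in \<open>c\<^sup>s a\<^sup>i c\<^sup>-\<^sup>s = c\<^bsup>s (1 - \<rho>\<^sup>i)\<^esup> a\<^sup>i\<close>. So \<open>s\<close> parametrizes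
  the conjugations by powers of \<open>c\<close>, and it is this choice of parameter that makes composition affine.
\<close>

definition affine :: "int \<Rightarrow> int \<Rightarrow> int \<Rightarrow> int \<Rightarrow> int \<times> int \<times> int \<Rightarrow> int \<times> int \<times> int" where
  "affine s u m v = restrict (\<lambda>(k, i, j).
     ((u * k + s * (1 - \<rho> ^ nat i)) mod int N, i, (m * i + v * j) mod int q)) (carrier M)"

lemma affine_apply:
  "(k, i, j) \<in> carrier M \<Longrightarrow> affine s u m v (k, i, j) =
     ((u * k + s * (1 - \<rho> ^ nat i)) mod int N, i, (m * i + v * j) mod int q)"
  by (simp add: affine_def)

lemma affine_closed: "x \<in> carrier M \<Longrightarrow> affine s u m v x \<in> carrier M"
  using N_gt_1 q_gt_1 by (cases x) (auto simp: affine_apply carrier_M)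

lemma affine_hom: "affine s u m v \<in> hom M M"
proof (rule homI)
  fix x y assume xy: "x \<in> carrier M" "y \<in> carrier M"
  obtain k i j k' i' j' where [simp]: "x = (k, i, j)" "y = (k', i', j')"
    by (cases x, cases y)
  have pos: "i \<ge> 0" "i' \<ge> 0" using xy by (auto simp: carrier_M)
  have pow: "[\<rho> ^ nat ((i + i') mod int q) = \<rho> ^ nat i * \<rho> ^ nat i'] (mod int N)"
    using rho_pow_mod[of "i + i'"] pos by (simp add: nat_add_distrib power_add)
  have "[u * (k + \<rho> ^ nat i * k') + s * (1 - \<rho> ^ nat ((i + i') mod int q))
       = u * (k + \<rho> ^ nat i * k') + s * (1 - \<rho> ^ nat i * \<rho> ^ nat i')] (mod int N)"
    by (intro cong_add cong_mult cong_diff cong_refl pow)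
  also have "u * (k + \<rho> ^ nat i * k') + s * (1 - \<rho> ^ nat i * \<rho> ^ nat i') =
      (u * k + s * (1 - \<rho> ^ nat i)) + \<rho> ^ nat i * (u * k' + s * (1 - \<rho> ^ nat i'))"
    by (simp add: algebra_simps)
  finally have 1: "(u * ((k + \<rho> ^ nat i * k') mod int N) + s * (1 - \<rho> ^ nat ((i + i') mod int q))) mod int N =
      ((u * k + s * (1 - \<rho> ^ nat i)) mod int N + \<rho> ^ nat i * ((u * k' + s * (1 - \<rho> ^ nat i')) mod int N)) mod int N"
    by (simp add: cong_def mod_mult_add_eq mod_add_left_eq)
  have "m * (i + i') + v * (j + j') = (m * i + v * j) + (m * i' + v * j')"
    by (simp add: algebra_simps)
  then have 2: "(m * ((i + i') mod int q) + v * ((j + j') mod int q)) mod int q =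
      ((m * i + v * j) mod int q + (m * i' + v * j') mod int q) mod int q"
    by (simp add: mod_mult_add_eq mod_simps)
  have "x \<otimes>\<^bsub>M\<^esub> y \<in> carrier M" using xy by simp
  with xy 1 2 show "affine s u m v (x \<otimes>\<^bsub>M\<^esub> y) = affine s u m v x \<otimes>\<^bsub>M\<^esub> affine s u m v y"
    using N_gt_1 by (simp add: mult_M affine_apply carrier_M)
qed (rule affine_closed)

lemma affine_auto:
  assumes "coprime u (int N)" "coprime v (int q)"
  shows "affine s u m v \<in> auto M"
  unfolding auto_iff iso_iff
proof (intro conjI)
  show inj: "inj_on (affine s u m v) (carrier M)"
  proof (rule inj_onI)
    fix x y assume xy: "x \<in> carrier M" "y \<in> carrier M" and eq: "affine s u m v x = affine s u m v y"
    obtain k i j k' i' j' where [simp]: "x = (k, i, j)" "y = (k', i', j')"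
      by (cases x, cases y)
    have [simp]: "i' = i" using xy eq by (simp add: affine_apply)
    have "[u * k + s * (1 - \<rho> ^ nat i) = u * k' + s * (1 - \<rho> ^ nat i)] (mod int N)"
      and "[m * i + v * j = m * i + v * j'] (mod int q)"
      using xy eq by (simp_all add: affine_apply cong_def)
    then have "[k = k'] (mod int N)" "[j = j'] (mod int q)"
      using assms by (simp_all add: cong_add_lcancel cong_add_rcancel cong_mult_lcancel)
    then show "x = y"
      using xy by (simp add: carrier_M cong_def)
  qed
  show "affine s u m v ` carrier M = carrier M"
    by (intro endo_inj_surj inj) (auto simp: affine_closed, simp add: carrier_M)
qed (simp_all only: affine_hom, simp add: affine_def)

lemma affine_cong:
  assumes "[s = s'] (mod int N)" "[u = u'] (mod int N)" "[m = m'] (mod int q)" "[v = v'] (mod int q)"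
  shows "affine s u m v = affine s' u' m' v'"
proof -
  have "[u * k + s * (1 - \<rho> ^ nat i) = u' * k + s' * (1 - \<rho> ^ nat i)] (mod int N)"
    and "[m * i + v * j = m' * i + v' * j] (mod int q)" for k i j
    by (intro cong_add cong_mult assms cong_refl)+
  then show ?thesis by (auto simp: affine_def cong_def intro!: restrict_ext)
qed

lemma affine_compose:
  "compose (carrier M) (affine s u m v) (affine s' u' m' v') =
   affine (s + u * s') (u * u') (m + v * m') (v * v')"
proof
  fix x
  show "compose (carrier M) (affine s u m v) (affine s' u' m' v') x =
    affine (s + u * s') (u * u') (m + v * m') (v * v') x"
  proof (cases "x \<in> carrier M")
    case True
    obtain k i j where [simp]: "x = (k, i, j)" by (cases x)
    have "affine s' u' m' v' (k, i, j) \<in> carrier M" using True affine_closed by simp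
    then have "affine s u m v (affine s' u' m' v' (k, i, j)) =
      ((u * (u' * k + s' * (1 - \<rho> ^ nat i)) + s * (1 - \<rho> ^ nat i)) mod int N, i,
       (m * i + v * (m' * i + v' * j)) mod int q)"
      using True by (simp add: affine_apply mod_mult_add_eq)
    then show ?thesis using True
      by (simp add: compose_def affine_apply algebra_simps)
  qed (simp add: compose_def affine_def)
qed

lemma affine_eqD:
  assumes "affine s u m v = affine s' u' m' v'"
  shows "[s = s'] (mod int N)" "[u = u'] (mod int N)" "[m = m'] (mod int q)" "[v = v'] (mod int q)"
proof -
  have eq: "affine s u m v (\<gamma> x) = affine s' u' m' v' (\<gamma> x)" for x
    by (simp add: assms)
  have "coprime (1 - \<rho>) (int N)"
    using coprime_rho by (metis coprime_minus_left_iff minus_diff_eq)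
  moreover have "[s * (1 - \<rho>) = s' * (1 - \<rho>)] (mod int N)"
    using eq[of gen_a] gens.gen_closed[of gen_a] by (simp add: affine_apply cong_def)
  ultimately show "[s = s'] (mod int N)" by (simp add: cong_mult_rcancel)
  show "[m = m'] (mod int q)"
    using eq[of gen_a] gens.gen_closed[of gen_a] by (simp add: affine_apply cong_def)
  show "[u = u'] (mod int N)"
    using eq[of gen_c] gens.gen_closed[of gen_c] by (simp add: affine_apply cong_def)
  show "[v = v'] (mod int q)"
    using eq[of gen_b] gens.gen_closed[of gen_b] by (simp add: affine_apply cong_def)
qed

text \<open>
  The image of \<open>c\<close> has no component in \<open>\<int>\<^sub>q \<times> \<int>\<^sub>q\<close> because the orders are coprime. The relation
  between \<open>a\<close> and \<open>c\<close> forces the image of \<open>a\<close> to act on \<open>c\<close> just as \<open>a\<close> does. The image of \<open>b\<close>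
  commutes with the images of \<open>c\<close> and \<open>a\<close>, which removes first its \<open>a\<close>-component and then its
  \<open>c\<close>-component. Injectivity on the subgroups generated by \<open>c\<close> and by \<open>b\<close> makes \<open>u\<close> and \<open>v\<close> units.
\<close>

lemma auto_is_affine:
  assumes f: "f \<in> auto M"
  obtains s u m v where "s \<in> {0..<int N}" "coprime u (int N)" "m \<in> {0..<int q}" "coprime v (int q)"
    "f = affine s u m v"
proof -
  have f_hom: "f \<in> hom M M" and f_inj: "inj_on f (carrier M)"
    using f by (simp_all add: auto_iff iso_iff)
  interpret f: group_hom M M f
    using f_hom by (simp add: group_hom_def group_hom_axioms_def M.is_group)

  have a: "(0, 1, 0) \<in> carrier M" and b: "(0, 0, 1) \<in> carrier M" and c: "(1, 0, 0) \<in> carrier M"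
    using gens.gen_closed[of gen_a] gens.gen_closed[of gen_b] gens.gen_closed[of gen_c] by simp_all
  obtain s0 i0 m where fa: "f (0, 1, 0) = (s0, i0, m)" by (cases "f (0, 1, 0)")
  obtain k1 i1 v where fb: "f (0, 0, 1) = (k1, i1, v)" by (cases "f (0, 0, 1)")
  obtain u i2 j2 where fc: "f (1, 0, 0) = (u, i2, j2)" by (cases "f (1, 0, 0)")
  have ranges: "s0 \<in> {0..<int N}" "i0 \<in> {0..<int q}" "m \<in> {0..<int q}"
    "k1 \<in> {0..<int N}" "i1 \<in> {0..<int q}" "v \<in> {0..<int q}" "u \<in> {0..<int N}"
    using f.hom_closed[OF a] f.hom_closed[OF b] f.hom_closed[OF c] by (simp_all add: fa fb fc carrier_M)

  have c_in: "1 \<in> carrier (integer_mod_group N)" and q_in: "1 \<in> carrier (integer_mod_group q)"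
    using N_gt_1 q_gt_1 by simp_all
  have "(\<lambda>(k, i, j). i) \<circ> (f \<circ> (\<lambda>k. (k, 0, 0))) \<in> hom (integer_mod_group N) (integer_mod_group q)"
    by (intro hom_compose[OF hom_compose[OF c_hom f_hom]] homI)
      (auto simp: carrier_M mult_M carrier_integer_mod_group)
  from hom_integer_mod_group_coprime[OF this coprime_N_q _ c_in] have i2: "i2 = 0"
    using q_gt_1 by (simp add: fc)
  have "(\<lambda>(k, i, j). j) \<circ> (f \<circ> (\<lambda>k. (k, 0, 0))) \<in> hom (integer_mod_group N) (integer_mod_group q)"
    by (intro hom_compose[OF hom_compose[OF c_hom f_hom]] homI)
      (auto simp: carrier_M mult_M carrier_integer_mod_group)
  from hom_integer_mod_group_coprime[OF this coprime_N_q _ c_in] have j2: "j2 = 0"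
    using q_gt_1 by (simp add: fc)

  have f_c: "f (k, 0, 0) = ((u * k) mod int N, 0, 0)" if "k \<in> {0..<int N}" for k
  proof -
    have "(k, 0, 0) = \<gamma> gen_c [^]\<^bsub>M\<^esub> k"
      using that by (simp only: c_pow) simp
    then have "f (k, 0, 0) = f (\<gamma> gen_c) [^]\<^bsub>M\<^esub> k"
      by (simp only: f.hom_int_pow[OF gens.gen_closed])
    also have "\<dots> = (\<gamma> gen_c [^]\<^bsub>M\<^esub> u) [^]\<^bsub>M\<^esub> k"
      using ranges by (subst c_pow) (simp add: fc i2 j2)
    also have "\<dots> = ((u * k) mod int N, 0, 0)"
      by (subst M.int_pow_pow) (rule gens.gen_closed, simp only: c_pow)
    finally show ?thesis .
  qed
  have coprime_u: "coprime u (int N)"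
  proof (rule coprime_if_inj_scaling)
    show "inj_on (\<lambda>x. u * x mod int N) {0..<int N}"
    proof (rule inj_onI)
      fix x y assume xy: "x \<in> {0..<int N}" "y \<in> {0..<int N}" "u * x mod int N = u * y mod int N"
      then have "f (x, 0, 0) = f (y, 0, 0)" by (simp add: f_c)
      then show "x = y" using xy q_gt_1 inj_onD[OF f_inj, of "(x, 0, 0)" "(y, 0, 0)"]
        by (simp add: carrier_M)
    qed
  qed (use N_gt_1 in simp)

  \<comment> \<open>Apply \<open>f\<close> to the relation \<open>a c = c\<^sup>\<rho> a\<close>, with \<open>\<rho>\<close> reduced modulo \<open>N\<close>.\<close>
  have i0: "i0 = 1"
  proof -
    define t where "t = \<rho> mod int N"
    have t: "t \<in> {0..<int N}" using N_gt_1 by (simp add: t_def)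
    have "(0, 1, 0) \<otimes>\<^bsub>M\<^esub> (1, 0, 0) = (t, 0, 0) \<otimes>\<^bsub>M\<^esub> (0, 1, 0)"
      using N_gt_1 q_gt_1 t by (simp add: mult_M t_def)
    then have "f (0, 1, 0) \<otimes>\<^bsub>M\<^esub> f (1, 0, 0) = f (t, 0, 0) \<otimes>\<^bsub>M\<^esub> f (0, 1, 0)"
      using a c t q_gt_1 by (metis f.hom_mult carrier_M mem_Sigma_iff atLeastLessThan_iff of_nat_0_less_iff order_refl gr_implies_not0 neq0_conv)
    then have "[s0 + \<rho> ^ nat i0 * u = u * t + s0] (mod int N)"
      using ranges t N_gt_1 by (simp add: fa fc i2 j2 f_c mult_M cong_def mod_simps)
    also have "[u * t + s0 = s0 + \<rho> ^ 1 * u] (mod int N)"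
      by (simp add: t_def cong_def mod_mult_add_eq ac_simps)
    finally have "[\<rho> ^ nat i0 = \<rho> ^ 1] (mod int N)"
      using coprime_u by (simp add: cong_add_lcancel cong_mult_rcancel)
    then have "nat i0 = 1"
      using ranges q_gt_1 by (intro rho_pow_inj) auto
    then show ?thesis by simp
  qed

  have i1: "i1 = 0"
  proof -
    have "(0, 0, 1) \<otimes>\<^bsub>M\<^esub> (1, 0, 0) = (1, 0, 0) \<otimes>\<^bsub>M\<^esub> (0, 0, 1)"
      using N_gt_1 q_gt_1 by (simp add: mult_M)
    then have "f (0, 0, 1) \<otimes>\<^bsub>M\<^esub> f (1, 0, 0) = f (1, 0, 0) \<otimes>\<^bsub>M\<^esub> f (0, 0, 1)"
      using b c by (metis f.hom_mult)
    then have "[k1 + \<rho> ^ nat i1 * u = u + k1] (mod int N)"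
      using ranges by (simp add: fb fc i2 j2 mult_M cong_def)
    then have "[k1 + \<rho> ^ nat i1 * u = k1 + 1 * u] (mod int N)"
      by (simp add: ac_simps)
    then have "[\<rho> ^ nat i1 = 1] (mod int N)"
      using coprime_u by (subst (asm) cong_add_lcancel) (subst (asm) cong_mult_rcancel, auto)
    then have "nat i1 = 0"
      using ranges by (intro rho_pow_eq_1) auto
    then show ?thesis using ranges by simp
  qed

  have k1: "k1 = 0"
  proof -
    have "(0, 0, 1) \<otimes>\<^bsub>M\<^esub> (0, 1, 0) = (0, 1, 0) \<otimes>\<^bsub>M\<^esub> (0, 0, 1)"
      using N_gt_1 q_gt_1 by (simp add: mult_M)
    then have "f (0, 0, 1) \<otimes>\<^bsub>M\<^esub> f (0, 1, 0) = f (0, 1, 0) \<otimes>\<^bsub>M\<^esub> f (0, 0, 1)"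
      using a b by (metis f.hom_mult)
    then have "[k1 + s0 = s0 + \<rho> * k1] (mod int N)"
      using ranges by (simp add: fa fb i0 i1 mult_M cong_def)
    then have "int N dvd (k1 + s0) - (s0 + \<rho> * k1)" by (simp add: cong_iff_dvd_diff)
    also have "(k1 + s0) - (s0 + \<rho> * k1) = (\<rho> - 1) * (- k1)" by (simp add: algebra_simps)
    finally have "int N dvd k1"
      using coprime_rho by (simp add: coprime_commute coprime_dvd_mult_right_iff)
    then show ?thesis using ranges zdvd_not_zless[of k1 "int N"] by (cases "k1 = 0") auto
  qed

  have f_b: "f (0, 0, j) = (0, 0, (v * j) mod int q)" if "j \<in> {0..<int q}" for j
  proof -
    have "(0, 0, j) = \<gamma> gen_b [^]\<^bsub>M\<^esub> j"
      using that by (simp only: b_pow) simp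
    then have "f (0, 0, j) = f (\<gamma> gen_b) [^]\<^bsub>M\<^esub> j"
      by (simp only: f.hom_int_pow[OF gens.gen_closed])
    also have "\<dots> = (\<gamma> gen_b [^]\<^bsub>M\<^esub> v) [^]\<^bsub>M\<^esub> j"
      using ranges by (subst b_pow) (simp add: fb i1 k1)
    also have "\<dots> = (0, 0, (v * j) mod int q)"
      by (subst M.int_pow_pow) (rule gens.gen_closed, simp only: b_pow)
    finally show ?thesis .
  qed
  have coprime_v: "coprime v (int q)"
  proof (rule coprime_if_inj_scaling)
    show "inj_on (\<lambda>x. v * x mod int q) {0..<int q}"
    proof (rule inj_onI)
      fix x y assume xy: "x \<in> {0..<int q}" "y \<in> {0..<int q}" "v * x mod int q = v * y mod int q"
      then have "f (0, 0, x) = f (0, 0, y)" by (simp add: f_b)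
      then show "x = y" using xy N_gt_1 q_gt_1 inj_onD[OF f_inj, of "(0, 0, x)" "(0, 0, y)"]
        by (simp add: carrier_M)
    qed
  qed (use q_gt_1 in simp)

  have "coprime (1 - \<rho>) (int N)"
    using coprime_rho by (metis coprime_minus_left_iff minus_diff_eq)
  then obtain w where w: "[(1 - \<rho>) * w = 1] (mod int N)"
    using cong_solve_coprime_int by blast
  \<comment> \<open>The affine map with parameter \<open>s\<close> sends \<open>a\<close> to an element with first component
      \<open>s (1 - \<rho>)\<close>, and this has to be \<open>s0\<close>.\<close>
  define s where "s = (s0 * w) mod int N"
  have "[s * (1 - \<rho>) = s0 * ((1 - \<rho>) * w)] (mod int N)"
    by (simp only: s_def cong_def mod_mult_left_eq) (simp add: ac_simps)
  also have "[s0 * ((1 - \<rho>) * w) = s0 * 1] (mod int N)"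
    by (intro cong_mult cong_refl w)
  finally have s: "s * (1 - \<rho>) mod int N = s0"
    using ranges by (simp add: cong_def)
  have "f (\<gamma> x) = affine s u m v (\<gamma> x)" for x
    using ranges a b c s by (cases x) (auto simp: fa fb fc i0 i1 i2 j2 k1 affine_apply)
  then have "f y = affine s u m v y" if "y \<in> carrier M" for y
    using gens.hom_eqI[OF M.is_group f_hom affine_hom _ generated that] by blast
  then have "f = affine s u m v"
    using f by (intro extensionalityI[of f "carrier M"]) (auto simp: auto_iff affine_def)
  moreover have "s \<in> {0..<int N}" using N_gt_1 by (simp add: s_def)
  ultimately show ?thesis
    using that ranges coprime_u coprime_v by blast
qed

text \<open>
  The homomorphism goes from the semidirect product to the automorphism group and sends
  \<open>(s, x, m, y)\<close> to the affine map with the units \<open>u = g\<^sup>x\<close> and \<open>v = h\<^sup>y\<close>. The action \<open>\<phi>\<close> goes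
  through the first projection because \<open>m\<close> and \<open>v\<close> do not enter the composition law of \<open>s\<close>.
\<close>

theorem AutoGroup_M:
  assumes g: "residue_primroot N g" and h: "residue_primroot q h"
  defines "\<psi> \<equiv> scaling q (int h)" and "\<phi> \<equiv> scaling N (int g) \<circ> fst"
  shows "\<psi> \<in> hom (integer_mod_group (q - 1)) (AutoGroup (integer_mod_group q))"
    and "\<phi> \<in> hom (integer_mod_group (totient N) \<times>\<times>
                   semidirect_product (integer_mod_group q) (integer_mod_group (q - 1)) \<psi>)
                 (AutoGroup (integer_mod_group N))"
    and "AutoGroup M \<cong>
           semidirect_product (integer_mod_group N)
             (integer_mod_group (totient N) \<times>\<times>
               semidirect_product (integer_mod_group q) (integer_mod_group (q - 1)) \<psi>) \<phi>"
proof -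
  let ?Y = "semidirect_product (integer_mod_group q) (integer_mod_group (q - 1)) \<psi>"
  let ?X = "integer_mod_group (totient N) \<times>\<times> ?Y"
  let ?T = "semidirect_product (integer_mod_group N) ?X \<phi>"
  have pos: "totient N > 0" "q - 1 > 0" using N_gt_1 q_gt_1 by simp_all
  have totient_q: "totient q = q - 1" using prime_q by (rule totient_prime)
  show \<psi>: "\<psi> \<in> hom (integer_mod_group (q - 1)) (AutoGroup (integer_mod_group q))"
    unfolding \<psi>_def using primroot_power_totient[OF h] pos q_gt_1
    by (intro scaling_hom) (simp_all add: totient_q)
  then have group_Y: "group ?Y" by (intro group_semidirect_product) auto
  show \<phi>: "\<phi> \<in> hom ?X (AutoGroup (integer_mod_group N))"
    unfolding \<phi>_def using scaling_hom[OF _ _ primroot_power_totient[OF g]] N_gt_1 group_Y pos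
    by (simp add: hom_of_fst)
  have group_T: "group ?T"
    by (intro group_semidirect_product DirProd_group group_Y \<phi>) auto
  have carrier_T: "carrier ?T = {0..<int N} \<times> {0..<int (totient N)} \<times> {0..<int q} \<times> {0..<int (q - 1)}"
    using pos N_gt_1 q_gt_1 by (simp add: carrier_integer_mod_group)
  define F where "F = (\<lambda>(s, x, m, y). affine s (int g ^ nat x) m (int h ^ nat y))"
  have F_auto: "F t \<in> auto M" for t
    by (cases t) (simp only: F_def prod.case affine_auto primroot_coprime[OF g] primroot_coprime[OF h])
  have "F \<in> iso ?T (AutoGroup M)"
    unfolding iso_def
  proof (intro CollectI conjI homI)
    fix t t' assume t: "t \<in> carrier ?T" "t' \<in> carrier ?T"
    obtain s x m y s' x' m' y' where [simp]: "t = (s, x, m, y)" "t' = (s', x', m', y')"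
      by (cases t, cases t')
    have nonneg: "x \<ge> 0" "x' \<ge> 0" "y \<ge> 0" "y' \<ge> 0" using t unfolding carrier_T by auto
    have "t \<otimes>\<^bsub>?T\<^esub> t' =
        ((s + int g ^ nat x * s' mod int N) mod int N, (x + x') mod int (totient N),
         (m + int h ^ nat y * m' mod int q) mod int q, (y + y') mod int (q - 1))"
      using t by (simp add: \<phi>_def \<psi>_def scaling_def)
    then have "F (t \<otimes>\<^bsub>?T\<^esub> t') =
        affine ((s + int g ^ nat x * s' mod int N) mod int N)
          (int g ^ nat ((x + x') mod int (totient N)))
          ((m + int h ^ nat y * m' mod int q) mod int q)
          (int h ^ nat ((y + y') mod int (q - 1)))"
      by (simp add: F_def)
    also have "\<dots> = affine (s + int g ^ nat x * s') (int g ^ nat x * int g ^ nat x')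
          (m + int h ^ nat y * m') (int h ^ nat y * int h ^ nat y')"
      using pow_nat_mod_cong[OF primroot_power_totient[OF g] pos(1), of "x + x'"]
        pow_nat_mod_cong[OF primroot_power_totient[OF h], of "y + y'"] pos(2) nonneg
      by (intro affine_cong)
        (simp_all add: totient_q nat_add_distrib power_add, simp_all add: cong_def mod_simps)
    also have "\<dots> = F t \<otimes>\<^bsub>AutoGroup M\<^esub> F t'"
      unfolding mult_AutoGroup[OF F_auto F_auto] by (simp add: F_def affine_compose)
    finally show "F (t \<otimes>\<^bsub>?T\<^esub> t') = F t \<otimes>\<^bsub>AutoGroup M\<^esub> F t'" .
  next
    show "bij_betw F (carrier ?T) (carrier (AutoGroup M))"
      unfolding bij_betw_def
    proof
      show "inj_on F (carrier ?T)"
      proof (rule inj_onI)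
        fix t t' assume t: "t \<in> carrier ?T" "t' \<in> carrier ?T" and eq: "F t = F t'"
        obtain s x m y s' x' m' y' where [simp]: "t = (s, x, m, y)" "t' = (s', x', m', y')"
          by (cases t, cases t')
        from eq have "affine s (int g ^ nat x) m (int h ^ nat y) =
            affine s' (int g ^ nat x') m' (int h ^ nat y')"
          by (simp add: F_def)
        note cong = affine_eqD[OF this]
        have "s = s'" "m = m'" using cong(1,3) t unfolding carrier_T by (auto simp: cong_def)
        moreover have "x = x'"
          using t unfolding carrier_T by (intro primroot_power_inj[OF g N_gt_1 cong(2)]) auto
        moreover have "y = y'"
          using t unfolding carrier_T by (intro primroot_power_inj[OF h q_gt_1 cong(4)]) (auto simp: totient_q)
        ultimately show "t = t'" by simp
      qed
      show "F ` carrier ?T = carrier (AutoGroup M)"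
      proof
        show "carrier (AutoGroup M) \<subseteq> F ` carrier ?T"
        proof
          fix f assume "f \<in> carrier (AutoGroup M)"
          then have "f \<in> auto M" by (simp add: carrier_AutoGroup)
          then obtain s u m v where f: "s \<in> {0..<int N}" "coprime u (int N)" "m \<in> {0..<int q}"
            "coprime v (int q)" "f = affine s u m v"
            by (rule auto_is_affine)
          obtain x where x: "0 \<le> x" "x < int (totient N)" "[int g ^ nat x = u] (mod int N)"
            using primroot_power_exists[OF g N_gt_1 f(2)] by blast
          obtain y where y: "0 \<le> y" "y < int (q - 1)" "[int h ^ nat y = v] (mod int q)"
            using primroot_power_exists[OF h q_gt_1 f(4)] unfolding totient_q by blast
          have "f = F (s, x, m, y)"
            unfolding f(5) F_def using x y by (auto intro!: affine_cong simp: cong_sym)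
          moreover have "(s, x, m, y) \<in> carrier ?T"
            unfolding carrier_T using f x y by simp
          ultimately show "f \<in> F ` carrier ?T" by blast
        qed
      qed (auto simp: carrier_AutoGroup F_auto)
    qed
  qed (simp add: carrier_AutoGroup F_auto)
  then show "AutoGroup M \<cong> ?T"
    by (intro group.iso_sym[OF group_T] is_isoI)
qed

end

section \<open>Identifying the presented group\<close>

lemma (in group) int_pow_mod:
  assumes "x \<in> carrier G" "x [^] int n = \<one>"
  shows "x [^] (k mod int n) = x [^] k"
proof -
  have "x [^] k = x [^] (int n * (k div int n) + k mod int n)" by simp
  also have "\<dots> = (x [^] int n) [^] (k div int n) \<otimes> x [^] (k mod int n)"
    using assms(1) by (simp only: int_pow_mult int_pow_pow)
  finally show ?thesis using assms by (simp del: mult_div_mod_eq)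
qed

lemma (in group) semiconjugate_int_pow:
  assumes "a \<in> carrier G" "x \<in> carrier G" "y \<in> carrier G" "a \<otimes> x = y \<otimes> a"
  shows "a \<otimes> x [^] (k::int) = y [^] k \<otimes> a"
proof -
  have "inv a \<otimes> (a \<otimes> z) = z" if "z \<in> carrier G" for z
    using that assms(1) by (simp flip: m_assoc)
  then have "(\<lambda>z. a \<otimes> z \<otimes> inv a) \<in> hom G G"
    using assms(1) by (intro homI) (simp_all add: m_assoc)
  from hom_int_pow[OF this assms(2) is_group is_group, of k]
  have "a \<otimes> x [^] k \<otimes> inv a = (a \<otimes> x \<otimes> inv a) [^] k" by simp
  also have "a \<otimes> x \<otimes> inv a = y" using assms by (simp add: m_assoc)
  finally show ?thesis using assms by (metis int_pow_closed inv_solve_right' m_closed)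
qed

lemma (in group) commutator_eq_one_iff:
  assumes "x \<in> carrier G" "y \<in> carrier G"
  shows "inv x \<otimes> (inv y \<otimes> (x \<otimes> y)) = \<one> \<longleftrightarrow> x \<otimes> y = y \<otimes> x"
  using assms by (simp add: inv_solve_left')

text \<open>
  Moving \<open>C\<^sup>k\<close> to the left of \<open>A\<^sup>i\<close> multiplies the exponent by \<open>\<rho>\<^sup>i\<close>, as in the product of \<open>M\<close>.
  The torsion relations allow exponents to be reduced.
\<close>

lemma (in metacyclic_times_cyclic) hom_from_M:
  assumes "group P" and closed: "A \<in> carrier P" "B \<in> carrier P" "C \<in> carrier P"
    and A: "A [^]\<^bsub>P\<^esub> int q = \<one>\<^bsub>P\<^esub>" and B: "B [^]\<^bsub>P\<^esub> int q = \<one>\<^bsub>P\<^esub>"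
    and C: "C [^]\<^bsub>P\<^esub> int N = \<one>\<^bsub>P\<^esub>"
    and BA: "B \<otimes>\<^bsub>P\<^esub> A = A \<otimes>\<^bsub>P\<^esub> B" and BC: "B \<otimes>\<^bsub>P\<^esub> C = C \<otimes>\<^bsub>P\<^esub> B"
    and AC: "A \<otimes>\<^bsub>P\<^esub> C = C [^]\<^bsub>P\<^esub> \<rho> \<otimes>\<^bsub>P\<^esub> A"
  shows "(\<lambda>(k, i, j). C [^]\<^bsub>P\<^esub> k \<otimes>\<^bsub>P\<^esub> (A [^]\<^bsub>P\<^esub> i \<otimes>\<^bsub>P\<^esub> B [^]\<^bsub>P\<^esub> j)) \<in> hom M P"
proof -
  interpret P: group P by fact
  have commute: "y [^]\<^bsub>P\<^esub> (j::int) \<otimes>\<^bsub>P\<^esub> x [^]\<^bsub>P\<^esub> (k::int) = x [^]\<^bsub>P\<^esub> k \<otimes>\<^bsub>P\<^esub> y [^]\<^bsub>P\<^esub> j"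
    if "x \<in> carrier P" "y \<in> carrier P" "y \<otimes>\<^bsub>P\<^esub> x = x \<otimes>\<^bsub>P\<^esub> y" for x y j k
    using that P.semiconjugate_int_pow[of x y y j] P.semiconjugate_int_pow[of "y [^]\<^bsub>P\<^esub> j" x x k] by simp
  have AC1: "A \<otimes>\<^bsub>P\<^esub> C [^]\<^bsub>P\<^esub> k = C [^]\<^bsub>P\<^esub> (\<rho> * k) \<otimes>\<^bsub>P\<^esub> A" for k :: int
    using P.semiconjugate_int_pow[OF _ _ _ AC, of k] closed by (simp add: P.int_pow_pow)
  have ACn: "A [^]\<^bsub>P\<^esub> n \<otimes>\<^bsub>P\<^esub> C [^]\<^bsub>P\<^esub> k = C [^]\<^bsub>P\<^esub> (\<rho> ^ n * k) \<otimes>\<^bsub>P\<^esub> A [^]\<^bsub>P\<^esub> n" for n :: nat and k :: int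
  proof (induction n arbitrary: k)
    case 0
    then show ?case using closed by simp
  next
    case (Suc n)
    have "A [^]\<^bsub>P\<^esub> Suc n \<otimes>\<^bsub>P\<^esub> C [^]\<^bsub>P\<^esub> k = A [^]\<^bsub>P\<^esub> n \<otimes>\<^bsub>P\<^esub> C [^]\<^bsub>P\<^esub> (\<rho> * k) \<otimes>\<^bsub>P\<^esub> A"
      using closed by (simp add: P.m_assoc AC1)
    also have "\<dots> = C [^]\<^bsub>P\<^esub> (\<rho> ^ Suc n * k) \<otimes>\<^bsub>P\<^esub> A [^]\<^bsub>P\<^esub> Suc n"
      using closed by (simp add: P.m_assoc Suc.IH ac_simps)
    finally show ?case .
  qed
  show ?thesis
  proof (rule homI)
    fix x y assume "x \<in> carrier M" "y \<in> carrier M"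
    moreover obtain k i j k' i' j' where [simp]: "x = (k, i, j)" "y = (k', i', j')"
      by (cases x, cases y)
    ultimately have "i \<ge> 0" "k' \<in> {0..<int N}" by (auto simp: carrier_M)
    have Ai: "A [^]\<^bsub>P\<^esub> i \<otimes>\<^bsub>P\<^esub> C [^]\<^bsub>P\<^esub> k' = C [^]\<^bsub>P\<^esub> (\<rho> ^ nat i * k') \<otimes>\<^bsub>P\<^esub> A [^]\<^bsub>P\<^esub> i"
      using ACn[of "nat i" k'] \<open>i \<ge> 0\<close> by (simp flip: int_pow_int)
    let ?f = "\<lambda>(k, i, j). C [^]\<^bsub>P\<^esub> k \<otimes>\<^bsub>P\<^esub> (A [^]\<^bsub>P\<^esub> i \<otimes>\<^bsub>P\<^esub> B [^]\<^bsub>P\<^esub> j)"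
    have "?f x \<otimes>\<^bsub>P\<^esub> ?f y = C [^]\<^bsub>P\<^esub> k \<otimes>\<^bsub>P\<^esub> (A [^]\<^bsub>P\<^esub> i \<otimes>\<^bsub>P\<^esub> ((B [^]\<^bsub>P\<^esub> j \<otimes>\<^bsub>P\<^esub> C [^]\<^bsub>P\<^esub> k') \<otimes>\<^bsub>P\<^esub> (A [^]\<^bsub>P\<^esub> i' \<otimes>\<^bsub>P\<^esub> B [^]\<^bsub>P\<^esub> j')))"
      using closed by (simp add: P.m_assoc)
    also have "\<dots> = C [^]\<^bsub>P\<^esub> k \<otimes>\<^bsub>P\<^esub> ((A [^]\<^bsub>P\<^esub> i \<otimes>\<^bsub>P\<^esub> C [^]\<^bsub>P\<^esub> k') \<otimes>\<^bsub>P\<^esub> ((B [^]\<^bsub>P\<^esub> j \<otimes>\<^bsub>P\<^esub> A [^]\<^bsub>P\<^esub> i') \<otimes>\<^bsub>P\<^esub> B [^]\<^bsub>P\<^esub> j'))"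
      using closed by (simp add: commute[of C B] BC P.m_assoc)
    also have "\<dots> = (C [^]\<^bsub>P\<^esub> k \<otimes>\<^bsub>P\<^esub> C [^]\<^bsub>P\<^esub> (\<rho> ^ nat i * k')) \<otimes>\<^bsub>P\<^esub> ((A [^]\<^bsub>P\<^esub> i \<otimes>\<^bsub>P\<^esub> A [^]\<^bsub>P\<^esub> i') \<otimes>\<^bsub>P\<^esub> (B [^]\<^bsub>P\<^esub> j \<otimes>\<^bsub>P\<^esub> B [^]\<^bsub>P\<^esub> j'))"
      unfolding Ai using closed by (simp add: commute[of A B] BA P.m_assoc)
    also have "\<dots> = ?f (x \<otimes>\<^bsub>M\<^esub> y)"
      using closed \<open>k' \<in> _\<close>
      by (simp add: mult_M P.int_pow_mod[OF _ A] P.int_pow_mod[OF _ B] P.int_pow_mod[OF _ C] P.int_pow_mult)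
    finally show "?f (x \<otimes>\<^bsub>M\<^esub> y) = ?f x \<otimes>\<^bsub>P\<^esub> ?f y" ..
  qed (use closed in auto)
qed

lemma (in metacyclic_times_cyclic) gen_relations:
  assumes "[\<rho> * r = 1] (mod int N)"
  shows "\<gamma> gen_a [^]\<^bsub>M\<^esub> int q = \<one>\<^bsub>M\<^esub>"
    and "\<gamma> gen_b [^]\<^bsub>M\<^esub> int q = \<one>\<^bsub>M\<^esub>"
    and "\<gamma> gen_c [^]\<^bsub>M\<^esub> int N = \<one>\<^bsub>M\<^esub>"
    and "inv\<^bsub>M\<^esub> \<gamma> gen_a \<otimes>\<^bsub>M\<^esub> (inv\<^bsub>M\<^esub> \<gamma> gen_b \<otimes>\<^bsub>M\<^esub> (\<gamma> gen_a \<otimes>\<^bsub>M\<^esub> \<gamma> gen_b)) = \<one>\<^bsub>M\<^esub>"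
    and "inv\<^bsub>M\<^esub> \<gamma> gen_b \<otimes>\<^bsub>M\<^esub> (inv\<^bsub>M\<^esub> \<gamma> gen_c \<otimes>\<^bsub>M\<^esub> (\<gamma> gen_b \<otimes>\<^bsub>M\<^esub> \<gamma> gen_c)) = \<one>\<^bsub>M\<^esub>"
    and "inv\<^bsub>M\<^esub> \<gamma> gen_a \<otimes>\<^bsub>M\<^esub> (\<gamma> gen_c \<otimes>\<^bsub>M\<^esub> \<gamma> gen_a) = \<gamma> gen_c [^]\<^bsub>M\<^esub> r"
proof -
  show "\<gamma> gen_a [^]\<^bsub>M\<^esub> int q = \<one>\<^bsub>M\<^esub>" "\<gamma> gen_b [^]\<^bsub>M\<^esub> int q = \<one>\<^bsub>M\<^esub>" "\<gamma> gen_c [^]\<^bsub>M\<^esub> int N = \<one>\<^bsub>M\<^esub>"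
    unfolding a_pow b_pow c_pow one_M by simp_all
  have "\<gamma> gen_a \<otimes>\<^bsub>M\<^esub> \<gamma> gen_b = \<gamma> gen_b \<otimes>\<^bsub>M\<^esub> \<gamma> gen_a" "\<gamma> gen_b \<otimes>\<^bsub>M\<^esub> \<gamma> gen_c = \<gamma> gen_c \<otimes>\<^bsub>M\<^esub> \<gamma> gen_b"
    using N_gt_1 q_gt_1 by (simp_all add: mult_M)
  then show "inv\<^bsub>M\<^esub> \<gamma> gen_a \<otimes>\<^bsub>M\<^esub> (inv\<^bsub>M\<^esub> \<gamma> gen_b \<otimes>\<^bsub>M\<^esub> (\<gamma> gen_a \<otimes>\<^bsub>M\<^esub> \<gamma> gen_b)) = \<one>\<^bsub>M\<^esub>"
    and "inv\<^bsub>M\<^esub> \<gamma> gen_b \<otimes>\<^bsub>M\<^esub> (inv\<^bsub>M\<^esub> \<gamma> gen_c \<otimes>\<^bsub>M\<^esub> (\<gamma> gen_b \<otimes>\<^bsub>M\<^esub> \<gamma> gen_c)) = \<one>\<^bsub>M\<^esub>"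
    using M.commutator_eq_one_iff[OF gens.gen_closed gens.gen_closed] by blast+
  have "\<gamma> gen_c \<otimes>\<^bsub>M\<^esub> \<gamma> gen_a = \<gamma> gen_a \<otimes>\<^bsub>M\<^esub> \<gamma> gen_c [^]\<^bsub>M\<^esub> r"
    unfolding c_pow using assms N_gt_1 q_gt_1 by (simp add: mult_M cong_def mod_mult_right_eq)
  then show "inv\<^bsub>M\<^esub> \<gamma> gen_a \<otimes>\<^bsub>M\<^esub> (\<gamma> gen_c \<otimes>\<^bsub>M\<^esub> \<gamma> gen_a) = \<gamma> gen_c [^]\<^bsub>M\<^esub> r"
    by (simp only: M.inv_solve_left' gens.gen_closed M.m_closed M.int_pow_closed)
qed

lemma abc_group_iso:
  assumes "metacyclic_times_cyclic (p\<^sup>2) q \<rho>" and rho_r: "[\<rho> * r = 1] (mod int (p\<^sup>2))"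
  shows "metacyclic_times_cyclic.M (p\<^sup>2) q \<rho> \<cong> abc_group p q r"
proof -
  interpret metacyclic_times_cyclic "p\<^sup>2" q \<rho> by fact
  define R where "R = abc_relations p q r"
  define P where "P = presented_group R"
  interpret P: group P by (simp add: P_def group_presented_group)
  interpret cls: generators_in_group P "\<lambda>x. word_class R (gen_word x)"
    unfolding P_def by (rule presented.generators_in_group_axioms)
  define A where "A = word_class R (gen_word gen_a)"
  define B where "B = word_class R (gen_word gen_b)"
  define C where "C = word_class R (gen_word gen_c)"
  have closed: "A \<in> carrier P" "B \<in> carrier P" "C \<in> carrier P"
    by (simp_all add: A_def B_def C_def)
  have "(pow_word (gen_word gen_a) (int q), []) \<in> R" "(pow_word (gen_word gen_b) (int q), []) \<in> R"
    "(pow_word (gen_word gen_c) (int (p\<^sup>2)), []) \<in> R"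
    "(comm_word (gen_word gen_a) (gen_word gen_b), []) \<in> R"
    "(comm_word (gen_word gen_b) (gen_word gen_c), []) \<in> R"
    "(inv_word (gen_word gen_a) @ gen_word gen_c @ gen_word gen_a, pow_word (gen_word gen_c) r) \<in> R"
    by (simp_all add: R_def abc_relations_def Let_def)
  note this[THEN presented_group_relation, folded P_def, unfolded cls.ev_simps cls.ev_Nil,
      folded A_def B_def C_def]
  then have A: "A [^]\<^bsub>P\<^esub> int q = \<one>\<^bsub>P\<^esub>" and B: "B [^]\<^bsub>P\<^esub> int q = \<one>\<^bsub>P\<^esub>"
    and C: "C [^]\<^bsub>P\<^esub> int (p\<^sup>2) = \<one>\<^bsub>P\<^esub>"
    and AB: "A \<otimes>\<^bsub>P\<^esub> B = B \<otimes>\<^bsub>P\<^esub> A" and BC: "B \<otimes>\<^bsub>P\<^esub> C = C \<otimes>\<^bsub>P\<^esub> B"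
    and CA: "C \<otimes>\<^bsub>P\<^esub> A = A \<otimes>\<^bsub>P\<^esub> C [^]\<^bsub>P\<^esub> r"
    using closed by (simp_all only: P.commutator_eq_one_iff P.inv_solve_left' P.m_closed P.int_pow_closed)
  have "A \<otimes>\<^bsub>P\<^esub> C [^]\<^bsub>P\<^esub> (r * \<rho>) = C [^]\<^bsub>P\<^esub> \<rho> \<otimes>\<^bsub>P\<^esub> A"
    using P.semiconjugate_int_pow[OF _ _ _ CA[symmetric], of \<rho>] closed by (simp add: P.int_pow_pow)
  moreover have "C [^]\<^bsub>P\<^esub> (r * \<rho>) = C"
  proof -
    have "C [^]\<^bsub>P\<^esub> (r * \<rho>) = C [^]\<^bsub>P\<^esub> ((\<rho> * r) mod int (p\<^sup>2))"
      using P.int_pow_mod[OF closed(3) C] by (simp add: mult.commute)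
    also have "(\<rho> * r) mod int (p\<^sup>2) = 1"
      using rho_r N_gt_1 by (simp add: cong_def del: of_nat_power)
    finally show ?thesis using closed by simp
  qed
  ultimately have AC: "A \<otimes>\<^bsub>P\<^esub> C = C [^]\<^bsub>P\<^esub> \<rho> \<otimes>\<^bsub>P\<^esub> A" by simp
  let ?f = "\<lambda>(k, i, j). C [^]\<^bsub>P\<^esub> k \<otimes>\<^bsub>P\<^esub> (A [^]\<^bsub>P\<^esub> i \<otimes>\<^bsub>P\<^esub> B [^]\<^bsub>P\<^esub> j)"
  have "?f \<in> iso M (presented_group R)"
  proof (rule gens.iso_presented_group)
    show "?f \<in> hom M (presented_group R)"
      using hom_from_M[OF P.is_group closed A B C AB[symmetric] BC AC] by (simp add: P_def)
    show "?f (\<gamma> x) = word_class R (gen_word x)" for x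
      using closed by (cases x) (simp_all, simp_all add: A_def B_def C_def)
    show "carrier M \<subseteq> range gens.ev" by (rule generated)
    show "gens.ev u = gens.ev v" if "(u, v) \<in> R" for u v
      using that unfolding R_def abc_relations_def Let_def
      by (elim insertE emptyE; simp only: prod.inject; elim conjE; hypsubst;
          simp only: gens.ev_simps gens.ev_Nil gen_relations[OF rho_r])
  qed
  then show ?thesis
    unfolding abc_group_def R_def by (rule is_isoI)
qed

theorem mainTheorem4:
  fixes p q :: nat and r :: int
  assumes "prime p" and "prime q" and "p \<noteq> q" and "p * q \<noteq> 6" and "q dvd p - 1"
    and "[r ^ q = 1] (mod int (p\<^sup>2))" and "\<not> [r = 1] (mod int (p\<^sup>2))"
  shows "\<exists>\<psi> \<in> hom (integer_mod_group (q - 1)) (AutoGroup (integer_mod_group q)).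
         \<exists>\<phi> \<in> hom (integer_mod_group (p * (p - 1)) \<times>\<times>
                    semidirect_product (integer_mod_group q) (integer_mod_group (q - 1)) \<psi>)
                  (AutoGroup (integer_mod_group (p\<^sup>2))).
           AutoGroup (abc_group p q r) \<cong>
             semidirect_product (integer_mod_group (p\<^sup>2))
               (integer_mod_group (p * (p - 1)) \<times>\<times>
                 semidirect_product (integer_mod_group q) (integer_mod_group (q - 1)) \<psi>) \<phi>"
proof -
  \<comment> \<open>The relation \<open>a\<^sup>-\<^sup>1 c a = c\<^sup>r\<close> gives the action of the inverse of \<open>a\<close>, so \<open>a\<close> itself acts by
      the inverse of \<open>r\<close>.\<close>
  define \<rho> where "\<rho> = r ^ (q - 1)"
  have p: "p > 1" and q: "q > 1" using assms(1,2) prime_gt_1_nat by blast+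
  have coprime_pq: "coprime p q" using assms(1-3) by (simp add: primes_coprime)
  have rho_r: "[\<rho> * r = 1] (mod int (p\<^sup>2))"
    using assms(6) q by (simp add: \<rho>_def flip: power_Suc2)
  have "\<rho> ^ q = (r ^ q) ^ (q - 1)"
    by (simp add: \<rho>_def mult.commute flip: power_mult)
  also have "[\<dots> = 1 ^ (q - 1)] (mod int (p\<^sup>2))"
    by (intro cong_pow assms(6))
  finally have rho_q: "[\<rho> ^ q = 1] (mod int (p\<^sup>2))" by simp
  have "\<not> int p dvd \<rho> - 1"
  proof
    assume "int p dvd \<rho> - 1"
    then have "[1 * r = \<rho> * r] (mod int p)"
      by (intro cong_mult cong_refl) (simp add: cong_iff_dvd_diff dvd_diff_commute)
    also have "[\<rho> * r = 1] (mod int p)"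
      using rho_r by (rule cong_dvd_modulus) simp
    finally have "[r = 1] (mod int p)" by simp
    then have "[r = 1] (mod int p ^ 2)"
      using assms(6) coprime_pq by (intro cong_1_lift[of r "int p" q]) (simp_all add: coprime_commute)
    with assms(7) show False by simp
  qed
  then have "coprime (\<rho> - 1) (int (p\<^sup>2))"
    using assms(1) by (simp add: coprime_commute prime_imp_coprime)
  then have model: "metacyclic_times_cyclic (p\<^sup>2) q \<rho>"
    using one_less_power[OF p, of 2] assms(2) coprime_pq rho_q by unfold_locales simp_all
  interpret metacyclic_times_cyclic "p\<^sup>2" q \<rho> by (rule model)
  have "p \<noteq> 2" using assms(5) q by auto
  then have "p > 2" using p by simp
  then have "odd p" using assms(1) prime_odd_nat by blast
  then obtain g where g: "residue_primroot (p\<^sup>2) g"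
    using residue_primroot_odd_prime_power_exists[OF assms(1)] by (metis zero_less_numeral)
  obtain h where h: "residue_primroot q h"
    using prime_primitive_root_exists[OF q assms(2)] by blast
  have totient: "totient (p\<^sup>2) = p * (p - 1)"
    using assms(1) by (simp add: totient_prime_power)
  have "AutoGroup (abc_group p q r) \<cong> AutoGroup M"
    using abc_group_iso[OF model rho_r] group_presented_group M.is_group
    by (intro AutoGroup_iso_cong M.iso_sym) (simp_all add: abc_group_def)
  also note AutoGroup_M(3)[OF g h]
  finally show ?thesis
    using AutoGroup_M(1,2)[OF g h] unfolding totient by blast
qed

end
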